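(* For positive integers $n$ and $j$, $$B_{n+j} = \sum_{k=1}^n P_j(k){n \brace k},$$ where $P_j(x)$ is the degree $j$ polynomial $P_j(x)=\sum_{r=0}^{j}B_{j-r}{j \choose r}x^r$.
   Context: For a nonnegative integer $n$, the Bell number $B_n$ is the number of partitions of an $n$-element set into nonempty subsets (so $B_0=1$). For integers $n,k$, the Stirling number of the second kind ${n \brace k}$ is the number of partitions of an $n$-element set into exactly $k$ nonempty subsets. *)

theory Defs
  imports
    "HOL-Computational_Algebra.Polynomial"
    "HOL-Combinatorics.Stirling"
    "HOL-Library.Disjoint_Sets"
begin

definition Bell :: "nat \<Rightarrow> nat"
  where "Bell n = card {P. partition_on {..<n} P}"

definition bell_shift_poly :: "nat \<Rightarrow> int poly"
  where "bell_shift_poly j = (\<Sum>r=0..j. monom (int (Bell (j - r) * (j choose r))) r)"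

text \<open>
  The library defines the Stirling numbers of the second kind by their recurrence.
  The following shows that they count the partitions of any finite set into a given
  number of blocks, and that the Bell numbers do not depend on the choice of the ground set.
\<close>

lemma card_partitions_insert:
  assumes A: "finite A" and a: "a \<notin> A"
  shows "card {P. partition_on (insert a A) P \<and> card P = Suc k} =
    Suc k * card {P. partition_on A P \<and> card P = Suc k} + card {P. partition_on A P \<and> card P = k}"
proof -
  define R where "R = {P. partition_on (insert a A) P \<and> card P = Suc k}"
  define R1 where "R1 = {P \<in> R. {a} \<in> P}"
  define R2 where "R2 = {P \<in> R. {a} \<notin> P}"
  define C where "C l = {P. partition_on A P \<and> card P = l}" for l
  have finC: "finite (C l)" for l
    unfolding C_def by (rule finite_subset[OF _ finitely_many_partition_on[OF A]]) auto
  have finR: "finite R"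
    unfolding R_def by (rule finite_subset[OF _ finitely_many_partition_on[of "insert a A"]]) (use A in auto)
  have finP: "finite P" if "partition_on A P" for P
    using A that by (meson finite_elements)
  have finP': "finite P" if "partition_on (insert a A) P" for P
    using A that by (meson finite_elements finite_insert)
  have notin: "a \<notin> q" if "Q \<in> C l" "q \<in> Q" for Q q l
    using that a by (auto simp: C_def partition_on_def)
  have "bij_betw (insert {a}) (C k) R1"
  proof (rule bij_betw_byWitness[where f' = "\<lambda>P. P - {{a}}"])
    show "\<forall>P\<in>C k. insert {a} P - {{a}} = P"
      using notin by blast
    show "\<forall>P\<in>R1. insert {a} (P - {{a}}) = P"
      by (auto simp: R1_def)
    show "insert {a} ` C k \<subseteq> R1"
    proof clarify
      fix P assume P: "P \<in> C k"
      then have "partition_on (insert a A) (insert {a} P)" "{a} \<notin> P"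
        using a by (auto simp: C_def partition_on_def disjoint_def)
      then show "insert {a} P \<in> R1"
        using P finP by (auto simp: R1_def R_def C_def)
    qed
    show "(\<lambda>P. P - {{a}}) ` R1 \<subseteq> C k"
    proof clarify
      fix P assume P: "P \<in> R1"
      then have d: "p \<inter> {a} = {}" if "p \<in> P" "p \<noteq> {a}" for p
        using that by (auto simp: R1_def R_def partition_on_def disjoint_def)
      have U: "\<Union>P = insert a A"
        using P by (auto simp: R1_def R_def partition_on_def)
      have "\<Union> (P - {{a}}) = A"
      proof (intro equalityI subsetI)
        fix x assume "x \<in> \<Union> (P - {{a}})"
        then show "x \<in> A" using U d by blast
      next
        fix x assume x: "x \<in> A"
        then obtain p where "p \<in> P" "x \<in> p" using U by blast
        then show "x \<in> \<Union> (P - {{a}})" using x a by blast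
      qed
      then have "partition_on A (P - {{a}})"
        using P by (auto simp: R1_def R_def partition_on_def disjoint_def)
      then show "P - {{a}} \<in> C k"
        using P finP' by (auto simp: R1_def R_def C_def)
    qed
  qed
  then have c1: "card R1 = card (C k)"
    by (simp add: bij_betw_same_card)
  define f where "f = (\<lambda>(Q, q). insert (insert a q) (Q - {q :: 'a set}))"
  have "bij_betw f (SIGMA Q:C (Suc k). Q) R2"
  proof (rule bij_betw_imageI)
    show "inj_on f (SIGMA Q:C (Suc k). Q)"
    proof (rule inj_onI, clarify)
      fix Q q Q' q'
      assume Q: "Q \<in> C (Suc k)" "q \<in> Q" and Q': "Q' \<in> C (Suc k)" "q' \<in> Q'"
        and eq: "f (Q, q) = f (Q', q')"
      have n: "\<And>p. p \<in> Q \<Longrightarrow> a \<notin> p" "\<And>p. p \<in> Q' \<Longrightarrow> a \<notin> p"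
        using notin Q Q' by blast+
      have "{p \<in> f (Q, q). a \<in> p} = {insert a q}" "{p \<in> f (Q', q'). a \<in> p} = {insert a q'}"
        "{p \<in> f (Q, q). a \<notin> p} = Q - {q}" "{p \<in> f (Q', q'). a \<notin> p} = Q' - {q'}"
        using n by (auto simp: f_def)
      then have i: "insert a q = insert a q'" and m: "Q - {q} = Q' - {q'}"
        using eq by auto
      have "q = q'"
        using i n Q Q' by (metis insert_ident)
      then show "Q = Q' \<and> q = q'"
        using m Q Q' by blast
    qed
    show "f ` (SIGMA Q:C (Suc k). Q) = R2"
    proof (intro equalityI subsetI)
      fix P assume "P \<in> f ` (SIGMA Q:C (Suc k). Q)"
      then obtain Q q where Q: "Q \<in> C (Suc k)" "q \<in> Q" and P: "P = insert (insert a q) (Q - {q})"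
        by (auto simp: f_def)
      have n: "\<And>p. p \<in> Q \<Longrightarrow> a \<notin> p"
        using notin Q by blast
      have pt: "\<Union>Q = A" "disjoint Q" "{} \<notin> Q"
        using Q by (auto simp: C_def partition_on_def)
      have "\<Union>P = insert a A"
        using pt Q by (auto simp: P)
      moreover have "disjoint P"
        using pt(2) n Q(2) unfolding P disjoint_def by blast
      moreover have "{} \<notin> P"
        using pt(3) by (auto simp: P)
      moreover have "{a} \<notin> P"
      proof -
        have "q \<noteq> {}" "a \<notin> q" using pt(3) n Q(2) by auto
        then have "insert a q \<noteq> {a}" by blast
        then show ?thesis using n by (auto simp: P)
      qed
      moreover have "card P = Suc k"
      proof -
        have "insert a q \<notin> Q - {q}" using n by blast
        moreover have "finite Q" "card Q = Suc k" using Q finP by (auto simp: C_def)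
        ultimately show ?thesis using Q(2) by (simp add: P)
      qed
      ultimately show "P \<in> R2"
        by (simp add: R2_def R_def partition_on_def)
    next
      fix P assume P: "P \<in> R2"
      then have pt: "\<Union>P = insert a A" "disjoint P" "{} \<notin> P" "{a} \<notin> P" "card P = Suc k" "finite P"
        using finP' by (auto simp: R2_def R_def partition_on_def)
      then obtain p where p: "p \<in> P" "a \<in> p" by blast
      define q where "q = p - {a}"
      define Q where "Q = insert q (P - {p})"
      have n: "a \<notin> p'" if "p' \<in> P - {p}" for p'
        using that p pt(2) by (auto simp: disjoint_def)
      have "p \<noteq> {a}"
        using p pt(4) by blast
      then have q: "p = insert a q" "q \<noteq> {}" "a \<notin> q"
        using p by (auto simp: q_def)
      have qP: "q \<notin> P - {p}"
      proof
        assume "q \<in> P - {p}"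
        then have "q \<inter> p = {}"
          using pt(2) p(1) by (auto simp: disjoint_def)
        then show False using q by blast
      qed
      have "a \<notin> \<Union>Q" "insert a (\<Union>Q) = \<Union>P"
        using n p q by (auto simp: Q_def)
      then have "\<Union>Q = A"
        using pt(1) a by (metis insert_ident)
      moreover have "disjoint Q"
        using pt(2) p unfolding Q_def q_def disjoint_def by blast
      moreover have "{} \<notin> Q"
        using pt(3) q by (auto simp: Q_def)
      moreover have "card Q = Suc k"
        using qP pt(5,6) p by (simp add: Q_def)
      ultimately have "Q \<in> C (Suc k)"
        by (simp add: C_def partition_on_def)
      moreover have "q \<in> Q" by (simp add: Q_def)
      moreover have "f (Q, q) = P"
        using qP p q(1) by (auto simp: f_def Q_def)
      ultimately show "P \<in> f ` (SIGMA Q:C (Suc k). Q)"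
        by force
    qed
  qed
  then have "card R2 = card (SIGMA Q:C (Suc k). Q)"
    by (simp add: bij_betw_same_card)
  also have "\<dots> = (\<Sum>Q\<in>C (Suc k). card Q)"
    using finC finP by (intro card_SigmaI) (auto simp: C_def)
  also have "\<dots> = Suc k * card (C (Suc k))"
    by (simp add: C_def)
  finally have c2: "card R2 = Suc k * card (C (Suc k))" .
  have "R = R1 \<union> R2" "R1 \<inter> R2 = {}"
    by (auto simp: R1_def R2_def)
  then have "card R = card R1 + card R2"
    using finR by (metis card_Un_disjoint finite_Un)
  then show ?thesis
    using c1 c2 by (simp add: R_def C_def)
qed

lemma card_partitions_eq_Stirling:
  assumes "finite A"
  shows "card {P. partition_on A P \<and> card P = k} = Stirling (card A) k"
  using assms
proof (induction A arbitrary: k rule: finite_induct)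
  case empty
  have "{P. partition_on {} P \<and> card P = k} = (if k = 0 then {{}} else {} :: 'a set set set)"
    by (auto simp: partition_on_empty)
  then show ?case by (cases k) (simp_all only: Stirling.simps card.empty if_True nat.distinct if_False refl, simp)
next
  case (insert a A)
  show ?case
  proof (cases k)
    case 0
    have "card P \<noteq> 0" if "partition_on (insert a A) P" for P
      using that insert.hyps finite_elements[of "insert a A" P]
      by (auto simp: partition_on_def)
    then have "{P. partition_on (insert a A) P \<and> card P = k} = {}"
      using 0 by blast
    then have "card {P. partition_on (insert a A) P \<and> card P = k} = 0"
      by (simp only: card.empty)
    also have "\<dots> = Stirling (card (insert a A)) k"
      using 0 insert.hyps by simp
    finally show ?thesis .
  next
    case (Suc l)
    have "card {P. partition_on (insert a A) P \<and> card P = Suc l} = Stirling (Suc (card A)) (Suc l)"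
      unfolding card_partitions_insert[OF insert.hyps] insert.IH by simp
    then show ?thesis
      unfolding Suc card_insert_disjoint[OF insert.hyps] .
  qed
qed

lemma card_partitions_eq_sum_Stirling:
  assumes "finite A"
  shows "card {P. partition_on A P} = (\<Sum>k\<le>card A. Stirling (card A) k)"
proof -
  have "card P \<le> card A" if "partition_on A P" for P
  proof (rule ccontr)
    assume "\<not> card P \<le> card A"
    then have "card {Q. partition_on A Q \<and> card Q = card P} = 0"
      using card_partitions_eq_Stirling[OF assms] by simp
    moreover have "finite {Q. partition_on A Q \<and> card Q = card P}"
      by (rule finite_subset[OF _ finitely_many_partition_on[OF assms]]) auto
    ultimately show False
      using that by auto
  qed
  then have "{P. partition_on A P} = (\<Union>k\<le>card A. {P. partition_on A P \<and> card P = k})"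
    by auto
  also have "card \<dots> = (\<Sum>k\<le>card A. card {P. partition_on A P \<and> card P = k})"
    by (rule card_UN_disjoint)
      (auto intro: finite_subset[OF _ finitely_many_partition_on[OF assms]])
  finally show ?thesis
    by (simp add: card_partitions_eq_Stirling[OF assms])
qed

lemma card_partitions_eq_Bell:
  assumes "finite A"
  shows "card {P. partition_on A P} = Bell (card A)"
  using card_partitions_eq_sum_Stirling[OF assms] card_partitions_eq_sum_Stirling[of "{..<card A}"]
  by (simp add: Bell_def)

end

theory Submission
  imports Defs
begin

text \<open>
  Let \<open>W(j, k)\<close> count the ways to add \<open>j\<close> further elements to a set already partitioned into \<open>k\<close>
  blocks. Placing the first new element in an old block or in a new one gives
  \<open>W(j + 1, k) = k W(j, k) + W(j, k + 1)\<close>. Against the recurrence of the Stirling numbers this lets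
  one trade an element of the \<open>n\<close>-set for an additional new element, so
  \<open>B\<^bsub>n + j\<^esub> = \<Sum>\<^sub>k W(j, k) S(n, k)\<close>, and in particular \<open>W(j, 0) = B\<^sub>j\<close>. On the other hand, choosing
  the \<open>r\<close> new elements that join \<open>m\<close> distinguished blocks gives
  \<open>W(j, k + m) = \<Sum>\<^sub>r (j choose r) m\<^sup>r W(j - r, k)\<close>, whose case \<open>k = 0\<close> is \<open>W(j, m) = P\<^sub>j(m)\<close>.
\<close>

fun r_Bell :: "nat \<Rightarrow> nat \<Rightarrow> nat" where
  "r_Bell 0 k = 1"
| "r_Bell (Suc j) k = k * r_Bell j k + r_Bell j (Suc k)"

lemma sum_Stirling_Suc_mult:
  fixes f :: "nat \<Rightarrow> nat"
  shows "(\<Sum>k\<le>Suc n. f k * Stirling (Suc n) k) = (\<Sum>k\<le>n. (k * f k + f (Suc k)) * Stirling n k)"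
proof -
  have "(\<Sum>k\<le>Suc n. f k * Stirling (Suc n) k) = (\<Sum>k\<le>n. f (Suc k) * Stirling (Suc n) (Suc k))"
    by (subst sum.atMost_Suc_shift) simp
  also have "\<dots> = (\<Sum>k\<le>n. Suc k * f (Suc k) * Stirling n (Suc k)) + (\<Sum>k\<le>n. f (Suc k) * Stirling n k)"
    by (simp add: sum.distrib[symmetric] algebra_simps)
  also have "(\<Sum>k\<le>n. Suc k * f (Suc k) * Stirling n (Suc k)) = (\<Sum>k\<le>Suc n. k * f k * Stirling n k)"
    by (subst sum.atMost_Suc_shift) simp
  \<comment> \<open>The top term vanishes because \<open>Stirling n (Suc n) = 0\<close>.\<close>
  also have "\<dots> = (\<Sum>k\<le>n. k * f k * Stirling n k)"
    by simp
  finally show ?thesis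
    by (simp add: sum.distrib[symmetric] algebra_simps)
qed

lemma Bell_add_eq_sum_r_Bell: "Bell (n + j) = (\<Sum>k\<le>n. r_Bell j k * Stirling n k)"
proof (induction j arbitrary: n)
  case 0
  show ?case
    using card_partitions_eq_sum_Stirling[of "{..<n}"] by (simp add: Bell_def)
next
  case (Suc j)
  show ?case
    \<comment> \<open>Passing to \<open>Suc n\<close> keeps the total while one new element moves
      into the n-set.\<close>
    using Suc.IH[of "Suc n"] by (simp only: sum_Stirling_Suc_mult r_Bell.simps add_Suc add_Suc_right)
qed

lemma r_Bell_0_right: "r_Bell j 0 = Bell j"
  using Bell_add_eq_sum_r_Bell[of 0 j] by simp

text \<open>Pascal's rule and an index shift.\<close>

lemma sum_choose_Suc_mult:
  fixes f :: "nat \<Rightarrow> nat"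
  shows "(\<Sum>r\<le>Suc j. (Suc j choose r) * f r) = (\<Sum>r\<le>j. (j choose r) * (f r + f (Suc r)))"
proof -
  have "(\<Sum>r\<le>Suc j. (Suc j choose r) * f r)
      = (f 0 + (\<Sum>r\<le>j. (j choose Suc r) * f (Suc r))) + (\<Sum>r\<le>j. (j choose r) * f (Suc r))"
    by (subst sum.atMost_Suc_shift) (simp add: sum.distrib algebra_simps)
  also have "f 0 + (\<Sum>r\<le>j. (j choose Suc r) * f (Suc r)) = (\<Sum>r\<le>Suc j. (j choose r) * f r)"
    by (subst sum.atMost_Suc_shift) simp
  also have "\<dots> = (\<Sum>r\<le>j. (j choose r) * f r)"
    by simp
  finally show ?thesis
    by (simp add: sum.distrib[symmetric] algebra_simps)
qed

lemma r_Bell_add: "r_Bell j (k + m) = (\<Sum>r\<le>j. (j choose r) * (m ^ r * r_Bell (j - r) k))"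
proof (induction j arbitrary: k)
  case 0
  show ?case by simp
next
  case (Suc j)
  \<comment> \<open>The m distinguished blocks are split off; the first two terms rebuild the
    recurrence in k.\<close>
  have "r_Bell (Suc j) (k + m)
      = k * r_Bell j (k + m) + r_Bell j (Suc k + m) + m * r_Bell j (k + m)"
    by (simp add: algebra_simps)
  also have "\<dots> = (\<Sum>r\<le>j. (j choose r) *
      (m ^ r * (k * r_Bell (j - r) k + r_Bell (j - r) (Suc k)) + m ^ Suc r * r_Bell (j - r) k))"
    unfolding Suc.IH by (simp add: sum_distrib_left sum.distrib[symmetric] algebra_simps)
  also have "\<dots> = (\<Sum>r\<le>j. (j choose r) *
      (m ^ r * r_Bell (Suc j - r) k + m ^ Suc r * r_Bell (Suc j - Suc r) k))"
    by (intro sum.cong) (simp_all add: Suc_diff_le)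
  finally show ?case
    by (simp only: sum_choose_Suc_mult)
qed

lemma poly_bell_shift_poly: "poly (bell_shift_poly j) (int k) = int (r_Bell j k)"
  using r_Bell_add[of j 0 k]
  by (simp add: bell_shift_poly_def poly_sum poly_monom r_Bell_0_right atMost_atLeast0 mult_ac)

lemma degree_bell_shift_poly: "degree (bell_shift_poly j) = j"
proof (rule antisym)
  show "degree (bell_shift_poly j) \<le> j"
    unfolding bell_shift_poly_def
    by (intro degree_sum_le) (auto intro: order.trans[OF degree_monom_le])
  \<comment> \<open>This coefficient is \<open>Bell 0\<close>, evaluated as
    \<open>r_Bell 0 0\<close>.\<close>
  have "coeff (bell_shift_poly j) j = 1"
    by (simp add: bell_shift_poly_def coeff_sum flip: r_Bell_0_right)
  then show "j \<le> degree (bell_shift_poly j)"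
    by (intro le_degree) simp
qed

theorem theorem1:
  fixes n j :: nat
  assumes "n > 0" and "j > 0"
  shows "degree (bell_shift_poly j) = j \<and>
    int (Bell (n + j)) = (\<Sum>k=1..n. poly (bell_shift_poly j) (int k) * int (Stirling n k))"
proof
  \<comment> \<open>Hence the sum may start at k = 1.\<close>
  have "Stirling n 0 = 0"
    using \<open>n > 0\<close> by (cases n) simp_all
  then have "Bell (n + j) = (\<Sum>k=1..n. r_Bell j k * Stirling n k)"
    by (simp add: Bell_add_eq_sum_r_Bell atMost_atLeast0 sum.atLeast_Suc_atMost)
  then show "int (Bell (n + j)) = (\<Sum>k=1..n. poly (bell_shift_poly j) (int k) * int (Stirling n k))"
    by (simp add: poly_bell_shift_poly)
qed (rule degree_bell_shift_poly)

end
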